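(* Let $\Lambda_{\mathcal F}(p)$ be the coin tossing integer self-similar set on the line with IFS $\mathcal F$ and parameter $p\in(0,1)$. If there exists an $a\in[L]$ such that the spectral radius of the matrix $p\cdot A_a$ is smaller than $1$, then almost surely $\Lambda_{\mathcal F}(p)$ does not contain any interval.
   Context: Notation: $[k]:=\{0,1,\dots,k-1\}$; "interval" means nondegenerate interval. IFS: $\mathcal F=\{f_i(x)=\frac1L x+t_i\}_{i=0}^{M-1}$ on $\mathbb R$, where $L\in\mathbb N$, $L\ge2$, $t_i\in\mathbb N$ ($0\in\mathbb N$), $0=t_0\le t_1\le\dots\le t_{M-1}$, and $L-1$ divides $t_{M-1}$. Repetitions among the $f_i$ are allowed. Write $f_{i_1\dots i_n}=f_{i_1}\circ\dots\circ f_{i_n}$. Coin tossing self-similar set: give each nonempty finite word $\mathbf i$ over $[M]$ an independent Bernoulli($p$) label. Let $\mathcal E_n\subset[M]^n$ be the random set of words $i_1\dots i_n$ such that all of the words $i_1,\ i_1i_2,\dots,\ i_1\dots i_n$ have label $1$. With $I=[0,\frac{L\,t_{M-1}}{L-1}]$ (so $f_i(I)\subset I$ for all $i$), $\Lambda_{\mathcal F}(p):=\bigcap_{n\ge1}\bigcup_{\mathbf i\in\mathcal E_n}f_{\mathbf i}(I)$. Distinct maps: let $\mathcal S=\{S_j(x)=\frac1Lx+t_j'\}_{j=0}^{m-1}$ be the distinct elements of $\mathcal F$ and $n_j=\#\{i\in[M]:f_i=S_j\}$. Let $\nu$ be the self-similar probability measure of $\mathcal S$ with weights $q_j=n_j/M$,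 i.e. the push-forward of the product measure $(q_0,\dots,q_{m-1})^{\mathbb N}$ under $i_1i_2\dots\mapsto\lim_n S_{i_1}\circ\dots\circ S_{i_n}(0)$. Basic types: $J^0,\dots,J^{N-1}$ are the finitely many intervals of the form $[(i-1)L,iL]$, $i\in\mathbb Z$, having positive $\nu$-measure, in increasing order (they cover the support of $\nu$). If $J^k=[uL,(u+1)L]$ and $a\in[L]$, then $J^k_a=[uL+a,\,uL+a+1]$. Matrices: for $a\in[L]$, $A_a$ is the $N\times N$ matrix, with rows and columns indexed by $[N]$, given by $A_a(\ell,k)=n_i$ if there is an $i\in[m]$ with $S_i(J^k)=J^\ell_a$ (such $i$ is unique), and $A_a(\ell,k)=0$ otherwise. *)

theory Defs
  imports "HOL-Probability.Probability" "Jordan_Normal_Form.Spectral_Radius"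
begin

(* Throughout, L is the inverse contraction ratio, M the number of maps (counted with
   repetition) and t i the translation of the i-th map; only t 0, ..., t (M - 1) matter.
   Words over [M] are lists of natural numbers below M. *)

definition compose_word :: "(nat \<Rightarrow> real \<Rightarrow> real) \<Rightarrow> nat list \<Rightarrow> real \<Rightarrow> real" where
  "compose_word g w = foldr (\<circ>) (map g w) id"

definition ifs_map :: "nat \<Rightarrow> (nat \<Rightarrow> nat) \<Rightarrow> nat \<Rightarrow> real \<Rightarrow> real" where
  "ifs_map L t i x = 1 / real L * x + real (t i)"

definition ifs_interval :: "nat \<Rightarrow> nat \<Rightarrow> (nat \<Rightarrow> nat) \<Rightarrow> real set" where
  "ifs_interval L M t = {0 .. real L * real (t (M - 1)) / (real L - 1)}"

definition nonempty_words :: "nat \<Rightarrow> nat list set" where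
  "nonempty_words M = {w. w \<noteq> [] \<and> set w \<subseteq> {..<M}}"

definition surviving_words :: "nat \<Rightarrow> (nat list \<Rightarrow> bool) \<Rightarrow> nat \<Rightarrow> nat list set" where
  "surviving_words M lab n =
     {w. length w = n \<and> set w \<subseteq> {..<M} \<and> (\<forall>k\<in>{1..n}. lab (take k w))}"

(* The coin tossing set for one realisation lab of the labels. *)
definition coin_tossing_set ::
  "nat \<Rightarrow> nat \<Rightarrow> (nat \<Rightarrow> nat) \<Rightarrow> (nat list \<Rightarrow> bool) \<Rightarrow> real set" where
  "coin_tossing_set L M t lab =
     (\<Inter>n\<in>{1..}. \<Union>w\<in>surviving_words M lab n.
        compose_word (ifs_map L t) w ` ifs_interval L M t)"

definition nondegenerate_interval :: "real set \<Rightarrow> bool" where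
  "nondegenerate_interval J \<longleftrightarrow> is_interval J \<and> (\<exists>x\<in>J. \<exists>y\<in>J. x < y)"

(* Two of the maps coincide iff their translations do, so the distinct maps are enumerated
   by increasing translation. *)
definition num_distinct :: "nat \<Rightarrow> (nat \<Rightarrow> nat) \<Rightarrow> nat" where
  "num_distinct M t = card (t ` {..<M})"

definition distinct_map :: "nat \<Rightarrow> nat \<Rightarrow> (nat \<Rightarrow> nat) \<Rightarrow> nat \<Rightarrow> real \<Rightarrow> real" where
  "distinct_map L M t j x = 1 / real L * x + real (sorted_list_of_set (t ` {..<M}) ! j)"

definition map_multiplicity :: "nat \<Rightarrow> nat \<Rightarrow> (nat \<Rightarrow> nat) \<Rightarrow> nat \<Rightarrow> nat" where
  "map_multiplicity L M t j = card {i \<in> {..<M}. ifs_map L t i = distinct_map L M t j}"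

definition weight_measure :: "nat \<Rightarrow> nat \<Rightarrow> (nat \<Rightarrow> nat) \<Rightarrow> nat measure" where
  "weight_measure L M t =
     point_measure {..<num_distinct M t} (\<lambda>j. ennreal (real (map_multiplicity L M t j) / real M))"

definition coding_map :: "nat \<Rightarrow> nat \<Rightarrow> (nat \<Rightarrow> nat) \<Rightarrow> (nat \<Rightarrow> nat) \<Rightarrow> real" where
  "coding_map L M t s = lim (\<lambda>n. compose_word (distinct_map L M t) (map s [0..<n]) 0)"

definition self_similar_measure :: "nat \<Rightarrow> nat \<Rightarrow> (nat \<Rightarrow> nat) \<Rightarrow> real measure" where
  "self_similar_measure L M t =
     distr (PiM UNIV (\<lambda>_::nat. weight_measure L M t)) borel (coding_map L M t)"

definition basic_indices :: "nat \<Rightarrow> nat \<Rightarrow> (nat \<Rightarrow> nat) \<Rightarrow> int set" where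
  "basic_indices L M t =
     {i. emeasure (self_similar_measure L M t)
           {of_int (i - 1) * real L .. of_int i * real L} > 0}"

definition num_basic :: "nat \<Rightarrow> nat \<Rightarrow> (nat \<Rightarrow> nat) \<Rightarrow> nat" where
  "num_basic L M t = card (basic_indices L M t)"

(* The integer u with J^k = [u L, (u + 1) L]. *)
definition basic_left :: "nat \<Rightarrow> nat \<Rightarrow> (nat \<Rightarrow> nat) \<Rightarrow> nat \<Rightarrow> int" where
  "basic_left L M t k = sorted_list_of_set (basic_indices L M t) ! k - 1"

definition basic_interval :: "nat \<Rightarrow> nat \<Rightarrow> (nat \<Rightarrow> nat) \<Rightarrow> nat \<Rightarrow> real set" where
  "basic_interval L M t k =
     {of_int (basic_left L M t k) * real L .. (of_int (basic_left L M t k) + 1) * real L}"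

definition basic_subinterval :: "nat \<Rightarrow> nat \<Rightarrow> (nat \<Rightarrow> nat) \<Rightarrow> nat \<Rightarrow> nat \<Rightarrow> real set" where
  "basic_subinterval L M t k a =
     {of_int (basic_left L M t k) * real L + real a ..
      of_int (basic_left L M t k) * real L + real a + 1}"

definition type_matrix :: "nat \<Rightarrow> nat \<Rightarrow> (nat \<Rightarrow> nat) \<Rightarrow> nat \<Rightarrow> real mat" where
  "type_matrix L M t a =
     mat (num_basic L M t) (num_basic L M t) (\<lambda>(l, k).
       let Q = (\<lambda>i. i < num_distinct M t \<and>
                    distinct_map L M t i ` basic_interval L M t k = basic_subinterval L M t l a)
       in if \<exists>i. Q i then real (map_multiplicity L M t (THE i. Q i)) else 0)"

end

theory Submission
  imports Defs
begin

text \<open>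
  A word \<open>w\<close> of length \<open>n\<close> acts by \<open>x \<mapsto> (x + L T(w)) / L^n\<close> with an integer \<open>T(w)\<close>, so it maps
  \<open>[u L, (u + 1) L]\<close> onto the \<open>L\<close>-adic interval \<open>L^(1 - n) [d, d + 1]\<close> exactly when \<open>T(w) = d - u\<close>.
  Every interval contains some \<open>L\<close>-adic interval; refine it by appending the digit \<open>a\<close> over and
  over. The numbers of words mapping the basic intervals onto the successive refinements satisfy a
  linear recursion with matrix \<open>A_a\<close>. A word of length \<open>n\<close> survives with probability \<open>p^n\<close>, so since
  \<open>p A_a\<close> has spectral radius below 1, the expected number of surviving words tends to 0.
  Hence almost surely some refinement is covered by no surviving word, and its midpoint is missing
  from the random set. Countably many initial \<open>L\<close>-adic intervals suffice.
\<close>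

section \<open>Linear recursions with a nonnegative matrix of spectral radius below 1\<close>

text \<open>Scaling a matrix by \<open>r\<close> scales its eigenvalues by \<open>r\<close>, so a
  gap below 1 leaves room for a factor above 1.\<close>

lemma spectral_radius_smult_less_1:
  fixes A :: "complex mat"
  assumes A: "A \<in> carrier_mat n n" and n: "0 < n" and sr: "spectral_radius A < 1"
  shows "\<exists>r>1. spectral_radius (complex_of_real r \<cdot>\<^sub>m A) < 1"
proof -
  have "0 \<le> spectral_radius A"
    using spectral_radius_mem_max(1)[OF A n] by auto
  \<comment> \<open>The reciprocal of the mean of 1 and the spectral radius; unlike the reciprocal
    of the spectral radius it also makes sense when that is 0.\<close>
  define r where "r = 2 / (1 + spectral_radius A)"
  have r: "1 < r" "r * spectral_radius A < 1"
    using sr \<open>0 \<le> spectral_radius A\<close> by (auto simp: r_def field_simps)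
  have rA: "complex_of_real r \<cdot>\<^sub>m A \<in> carrier_mat n n"
    using A by simp
  obtain z where z: "z \<in> spectrum (complex_of_real r \<cdot>\<^sub>m A)"
      and sz: "spectral_radius (complex_of_real r \<cdot>\<^sub>m A) = norm z"
    using spectral_radius_mem_max(1)[OF rA n] by auto
  obtain v where v: "v \<in> carrier_vec n" "v \<noteq> 0\<^sub>v n"
      and ev: "(complex_of_real r \<cdot>\<^sub>m A) *\<^sub>v v = z \<cdot>\<^sub>v v"
    using z A by (auto simp: spectrum_def eigenvalue_def eigenvector_def)
  have "A *\<^sub>v v = (z / r) \<cdot>\<^sub>v v"
  proof (rule eq_vecI)
    fix i assume "i < dim_vec ((z / r) \<cdot>\<^sub>v v)"
    then have i: "i < n" using v by simp
    have "complex_of_real r * (A *\<^sub>v v) $ i = z * v $ i"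
      using arg_cong[OF ev, of "\<lambda>x. x $ i"] i A v by simp
    then show "(A *\<^sub>v v) $ i = ((z / r) \<cdot>\<^sub>v v) $ i"
      using i v r(1) by (simp add: field_simps)
  qed (use A v in simp)
  then have "z / r \<in> spectrum A"
    using A v by (auto simp: spectrum_def eigenvalue_def eigenvector_def)
  then have "norm (z / r) \<le> spectral_radius A"
    using spectral_radius_mem_max(2)[OF A n] by auto
  then have "norm z \<le> r * spectral_radius A"
    using r by (simp add: norm_divide field_simps)
  then show ?thesis
    using r sz by (intro exI[of _ r]) simp
qed

text \<open>Nonnegative entries make \<open>y \<mapsto> y B\<close> monotone on row vectors, so the
  inequality iterates to \<open>y 0\<close> times a power of \<open>B\<close>. Row vectors fit
  because a column of \<open>A_a\<close> belongs to the type that is being mapped.\<close>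

lemma nonneg_mat_recursion_le:
  fixes B :: "real mat" and y :: "nat \<Rightarrow> nat \<Rightarrow> real"
  assumes B: "B \<in> carrier_mat N N"
    and nonneg: "\<And>i j. i < N \<Longrightarrow> j < N \<Longrightarrow> 0 \<le> B $$ (i, j)"
    and rec: "\<And>n k. k < N \<Longrightarrow> y (Suc n) k \<le> (\<Sum>l<N. B $$ (l, k) * y n l)"
    and k: "k < N"
  shows "y n k \<le> (\<Sum>j<N. (B ^\<^sub>m n) $$ (j, k) * y 0 j)"
  using k
proof (induction n arbitrary: k)
  case 0
  have "(\<Sum>j<N. (B ^\<^sub>m 0) $$ (j, k) * y 0 j) = (\<Sum>j<N. if j = k then y 0 j else 0)"
    using 0 B by (intro sum.cong) auto
  then show ?case using 0 by simp
next
  case (Suc n)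
  have Bn: "B ^\<^sub>m n \<in> carrier_mat N N" using B by (rule pow_carrier_mat)
  have entry: "(B ^\<^sub>m Suc n) $$ (j, k) = (\<Sum>l<N. (B ^\<^sub>m n) $$ (j, l) * B $$ (l, k))"
    if "j < N" for j
    using that Suc.prems B Bn by (simp add: scalar_prod_def atLeast0LessThan)
  have "y (Suc n) k \<le> (\<Sum>l<N. B $$ (l, k) * y n l)"
    using Suc.prems by (rule rec)
  also have "\<dots> \<le> (\<Sum>l<N. B $$ (l, k) * (\<Sum>j<N. (B ^\<^sub>m n) $$ (j, l) * y 0 j))"
    using Suc by (intro sum_mono mult_left_mono nonneg) auto
  also have "\<dots> = (\<Sum>j<N. \<Sum>l<N. (B ^\<^sub>m n) $$ (j, l) * B $$ (l, k) * y 0 j)"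
    by (subst sum.swap) (simp add: sum_distrib_left ac_simps)
  also have "\<dots> = (\<Sum>j<N. (B ^\<^sub>m Suc n) $$ (j, k) * y 0 j)"
    by (intro sum.cong) (auto simp: entry sum_distrib_right simp del: pow_mat.simps)
  finally show ?case .
qed

text \<open>
  The library bounds the powers of a matrix of spectral radius below 1; applied to a slightly
  enlarged matrix, this bound becomes geometric decay.
\<close>

lemma nonneg_mat_recursion_tendsto_0:
  fixes B :: "real mat" and y :: "nat \<Rightarrow> nat \<Rightarrow> real"
  assumes B: "B \<in> carrier_mat N N"
    and sr: "spectral_radius (map_mat complex_of_real B) < 1"
    and nonneg: "\<And>i j. i < N \<Longrightarrow> j < N \<Longrightarrow> 0 \<le> B $$ (i, j)"
    and y: "\<And>n k. k < N \<Longrightarrow> 0 \<le> y n k"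
    and rec: "\<And>n k. k < N \<Longrightarrow> y (Suc n) k \<le> (\<Sum>l<N. B $$ (l, k) * y n l)"
    and k: "k < N"
  shows "(\<lambda>n. y n k) \<longlonglongrightarrow> 0"
proof -
  have cB: "map_mat complex_of_real B \<in> carrier_mat N N" using B by simp
  obtain r where r: "1 < r"
      "spectral_radius (complex_of_real r \<cdot>\<^sub>m map_mat complex_of_real B) < 1"
    using spectral_radius_smult_less_1[OF cB _ sr] k by auto
  define D where "D = r \<cdot>\<^sub>m B"
  have D: "D \<in> carrier_mat N N" using B by (simp add: D_def)
  have cD: "complex_of_real r \<cdot>\<^sub>m map_mat complex_of_real B = map_mat complex_of_real D"
    using B by (intro eq_matI) (auto simp: D_def)
  have cD': "map_mat complex_of_real D \<in> carrier_mat N N" using D by simp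
  obtain c where c: "\<And>n. norm_bound (map_mat complex_of_real D ^\<^sub>m n) c"
    using spectral_radius_jnf_norm_bound_less_1_upper_triangular[OF cD'] r(2) cD by auto
  have bound: "(D ^\<^sub>m n) $$ (j, k) \<le> c" if "j < N" for j n
  proof -
    define E where "E = D ^\<^sub>m n"
    have E: "E \<in> carrier_mat N N" unfolding E_def using D by (rule pow_carrier_mat)
    have "map_mat complex_of_real D ^\<^sub>m n = map_mat complex_of_real E"
      unfolding E_def by (rule of_real_hom.mat_hom_pow[OF D, symmetric])
    then have "norm_bound (map_mat complex_of_real E) c" using c[of n] by simp
    then have "\<bar>E $$ (j, k)\<bar> \<le> c"
      using E that k by (auto simp: norm_bound_def)
    then have "E $$ (j, k) \<le> c" by simp
    then show ?thesis by (simp add: E_def)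
  qed
  \<comment> \<open>The rescaled \<open>y'\<close> obeys the recursion of \<open>D = r B\<close>,
    whose powers stay bounded; hence \<open>y n k\<close> is at most a constant times
    \<open>(1 / r) ^ n\<close>.\<close>
  define y' where "y' n j = r ^ n * y n j" for n j
  have "y' n k \<le> (\<Sum>j<N. (D ^\<^sub>m n) $$ (j, k) * y' 0 j)" for n
  proof (rule nonneg_mat_recursion_le[OF D _ _ k])
    fix i j assume "i < N" "j < N"
    then show "0 \<le> D $$ (i, j)" using nonneg[of i j] B r(1) by (simp add: D_def)
  next
    fix n k assume k: "k < N"
    have "y' (Suc n) k \<le> r ^ Suc n * (\<Sum>l<N. B $$ (l, k) * y n l)"
      unfolding y'_def using r(1) by (intro mult_left_mono rec k) auto
    also have "\<dots> = (\<Sum>l<N. D $$ (l, k) * y' n l)"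
      unfolding sum_distrib_left using B k
      by (intro sum.cong) (auto simp: D_def y'_def)
    finally show "y' (Suc n) k \<le> (\<Sum>l<N. D $$ (l, k) * y' n l)" .
  qed
  also have "\<And>n. (\<Sum>j<N. (D ^\<^sub>m n) $$ (j, k) * y' 0 j) \<le> (\<Sum>j<N. c * y' 0 j)"
    by (intro sum_mono mult_right_mono bound) (auto simp: y'_def y)
  finally have le: "r ^ n * y n k \<le> (\<Sum>j<N. c * y' 0 j)" for n
    by (simp add: y'_def)
  have lim: "(\<lambda>n. (\<Sum>j<N. c * y' 0 j) * (1 / r) ^ n) \<longlonglongrightarrow> 0"
    using r(1) by (intro tendsto_mult_right_zero LIMSEQ_power_zero) simp
  show ?thesis
  proof (rule tendsto_sandwich[OF _ _ tendsto_const lim])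
    show "\<forall>\<^sub>F n in sequentially. 0 \<le> y n k" using y k by simp
    show "\<forall>\<^sub>F n in sequentially. y n k \<le> (\<Sum>j<N. c * y' 0 j) * (1 / r) ^ n"
      using le r(1) by (intro always_eventually) (simp add: field_simps)
  qed
qed

section \<open>Words and their integer shifts\<close>

lemma compose_word_simps [simp]:
  "compose_word g [] = id"
  "compose_word g (i # w) = g i \<circ> compose_word g w"
  by (simp_all add: compose_word_def)

lemma compose_word_append: "compose_word g (v @ w) x = compose_word g v (compose_word g w x)"
  by (induction v) simp_all

lemma compose_word_map_cong:
  "(\<And>i. i \<in> set w \<Longrightarrow> g i = h (f i)) \<Longrightarrow> compose_word g w = compose_word h (map f w)"
  by (induction w) auto

text \<open>The integer \<open>T(w)\<close> of the overview, by Horner's rule: the first letter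
  carries the highest power of \<open>L\<close>.\<close>

definition word_shift :: "nat \<Rightarrow> (nat \<Rightarrow> nat) \<Rightarrow> nat list \<Rightarrow> int" where
  "word_shift L t w = foldl (\<lambda>s i. int L * s + int (t i)) 0 w"


lemma word_shift_simps [simp]:
  "word_shift L t [] = 0"
  "word_shift L t (w @ [i]) = int L * word_shift L t w + int (t i)"
  by (simp_all add: word_shift_def)

text \<open>With \<open>d - u\<close> in place of \<open>d\<close>, these are the words mapping
  \<open>[u L, (u + 1) L]\<close> onto \<open>L^(1 - n) [d, d + 1]\<close>. Letters come from
  \<open>[M]\<close>, so repeated maps are counted with multiplicity.\<close>

definition words_with_shift :: "nat \<Rightarrow> nat \<Rightarrow> (nat \<Rightarrow> nat) \<Rightarrow> nat \<Rightarrow> int \<Rightarrow> nat list set" where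
  "words_with_shift L M t n d = {w. length w = n \<and> set w \<subseteq> {..<M} \<and> word_shift L t w = d}"

lemma finite_words_with_shift [simp]: "finite (words_with_shift L M t n d)"
  by (rule finite_subset[OF _ finite_lists_length_eq[of "{..<M}" n]])
    (auto simp: words_with_shift_def)

section \<open>The action of words on the line\<close>

locale integer_ifs =
  fixes L M :: nat and t :: "nat \<Rightarrow> nat"
  assumes L: "2 \<le> L" and M: "1 \<le> M" and mono: "mono_on {..<M} t"
begin

abbreviation "f \<equiv> ifs_map L t"
abbreviation "I \<equiv> ifs_interval L M t"
abbreviation "translations \<equiv> sorted_list_of_set (t ` {..<M})"
abbreviation "m \<equiv> num_distinct M t"

text \<open>Each map is \<open>x \<mapsto> (x + L t_i) / L\<close>, and an appended letter
  \<open>i\<close> acts first, which turns \<open>T(w)\<close> into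
  \<open>L T(w) + t_i\<close>.\<close>

lemma compose_word_ifs_map:
  "compose_word f w x = (x + real L * of_int (word_shift L t w)) / real L ^ length w"
proof (induction w arbitrary: x rule: rev_induct)
  case (snoc i w)
  have "compose_word f (w @ [i]) x = compose_word f w (f i x)"
    by (simp add: compose_word_append)
  also have "\<dots> = (f i x + real L * of_int (word_shift L t w)) / real L ^ length w"
    by (rule snoc)
  finally show ?case using L by (simp add: ifs_map_def[of L t i] field_simps)
qed simp

lemma ifs_map_image: "f i ` {x * real L..y * real L} = {x + real (t i)..y + real (t i)}"
proof -
  have "f i = (\<lambda>z. (1 / real L) * z + real (t i))" by (simp add: fun_eq_iff ifs_map_def)
  moreover have "x * real L \<le> y * real L \<longleftrightarrow> x \<le> y" using L by simp
  ultimately show ?thesis using L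
    by (simp only: image_affinity_atLeastAtMost) (auto simp: field_simps)
qed

lemma ifs_map_mono: "x \<le> y \<Longrightarrow> f i x \<le> f i y"
  by (simp add: ifs_map_def divide_right_mono)

lemma compose_word_mono: "x \<le> y \<Longrightarrow> compose_word f w x \<le> compose_word f w y"
  by (induction w) (auto intro: ifs_map_mono)

lemma translation_le: "i < M \<Longrightarrow> t i \<le> t (M - 1)"
  using mono M by (auto simp: mono_on_def)

text \<open>The right end of \<open>I\<close> is the fixed point of the map with the largest
  translation.\<close>

lemma ifs_map_in_interval: "i < M \<Longrightarrow> x \<in> I \<Longrightarrow> f i x \<in> I"
proof -
  assume i: "i < M" and x: "x \<in> I"
  define T where "T = real (t (M - 1))"
  have T: "real (t i) \<le> T" using translation_le[OF i] by (simp add: T_def)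
  have x': "0 \<le> x" "x \<le> real L * T / (real L - 1)" using x by (auto simp: ifs_interval_def T_def)
  have "f i x \<le> 1 / real L * (real L * T / (real L - 1)) + T"
    unfolding ifs_map_def using x' T by (intro add_mono mult_left_mono) auto
  also have "\<dots> = real L * T / (real L - 1)" using L by (simp add: field_simps)
  finally show "f i x \<in> I" using x' by (auto simp: ifs_interval_def T_def ifs_map_def)
qed

lemma compose_word_in_interval: "set w \<subseteq> {..<M} \<Longrightarrow> x \<in> I \<Longrightarrow> compose_word f w x \<in> I"
  by (induction w) (auto intro: ifs_map_in_interval)

lemma zero_in_interval: "0 \<in> I"
  using L by (auto simp: ifs_interval_def)

lemma closed_compose_word_image: "closed (compose_word f w ` I)"
proof -
  have "compact (compose_word f w ` I)"
    by (rule compact_continuous_image)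
      (use L in \<open>auto simp: compose_word_ifs_map ifs_interval_def intro!: continuous_intros\<close>)
  then show ?thesis by (rule compact_imp_closed)
qed

text \<open>Since \<open>f i 0 \<ge> 0\<close>, the compositions increase inside \<open>I\<close>,
  so \<open>lim\<close> is a genuine limit. From index \<open>n\<close> on they lie in the closed
  image of \<open>I\<close> under the prefix of length \<open>n\<close>.\<close>

lemma compose_word_prefix_limit:
  assumes s: "\<And>k::nat. s k < M"
  defines "x \<equiv> lim (\<lambda>n. compose_word f (map s [0..<n]) 0)"
  shows "x \<in> compose_word f (map s [0..<n]) ` I"
proof -
  let ?c = "\<lambda>n. compose_word f (map s [0..<n]) 0"
  have cI: "?c n \<in> I" for n
    by (rule compose_word_in_interval) (use s zero_in_interval in auto)
  have "?c n \<le> ?c (Suc n)" for n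
    by (auto simp: compose_word_append ifs_map_def intro!: compose_word_mono)
  then have "incseq ?c" by (rule incseq_SucI)
  moreover have "\<forall>n. ?c n \<le> real L * real (t (M - 1)) / (real L - 1)"
    using cI by (auto simp: ifs_interval_def)
  ultimately obtain l where "?c \<longlonglongrightarrow> l"
    by (rule incseq_convergent)
  then have "convergent ?c" by (rule convergentI)
  then have lim: "?c \<longlonglongrightarrow> x" by (simp add: x_def convergent_LIMSEQ_iff)
  have in_img: "?c k \<in> compose_word f (map s [0..<n]) ` I" if "n \<le> k" for k
  proof -
    have "map s [0..<k] = map s [0..<n] @ map s [n..<k]"
      using that by (metis le0 map_append upt_add_eq_append le_add_diff_inverse)
    moreover have "compose_word f (map s [n..<k]) 0 \<in> I"
      by (rule compose_word_in_interval) (use s zero_in_interval in auto)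
    ultimately show ?thesis by (auto simp: compose_word_append)
  qed
  show ?thesis
    using in_img by (intro Lim_in_closed_set[OF closed_compose_word_image _ _ lim])
      (auto simp: eventually_sequentially)
qed

section \<open>Distinct maps and their multiplicities\<close>

lemma set_translations: "set translations = t ` {..<M}"
  and length_translations: "length translations = m"
  and distinct_translations: "distinct translations"
  by (simp_all add: num_distinct_def)

lemma translation_index: "i < M \<Longrightarrow> \<exists>j<m. translations ! j = t i"
  using set_translations length_translations by (metis image_eqI in_set_conv_nth lessThan_iff)

text \<open>Carries sequences over the distinct maps back to sequences over \<open>[M]\<close>,
  where the results on \<open>f\<close> apply.\<close>

definition representative :: "nat \<Rightarrow> nat" where
  "representative j = (SOME i. i < M \<and> t i = translations ! j)"

lemma representative:
  assumes "j < m"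
  shows "representative j < M" "t (representative j) = translations ! j"
proof -
  have "translations ! j \<in> t ` {..<M}"
    using assms by (metis set_translations length_translations nth_mem)
  then have "\<exists>i. i < M \<and> t i = translations ! j" by force
  then have "representative j < M \<and> t (representative j) = translations ! j"
    unfolding representative_def by (rule someI_ex)
  then show "representative j < M" "t (representative j) = translations ! j"
    by auto
qed

lemma distinct_map_representative: "j < m \<Longrightarrow> distinct_map L M t j = f (representative j)"
  using representative by (auto simp: distinct_map_def ifs_map_def)

lemma ifs_map_eq_distinct_map: "f i = distinct_map L M t j \<longleftrightarrow> t i = translations ! j"
  by (auto simp: fun_eq_iff ifs_map_def distinct_map_def)

lemma map_multiplicity_eq: "map_multiplicity L M t j = card {i \<in> {..<M}. t i = translations ! j}"
  unfolding map_multiplicity_def ifs_map_eq_distinct_map ..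

lemma map_multiplicity_pos: "j < m \<Longrightarrow> 0 < map_multiplicity L M t j"
  using representative by (auto simp: map_multiplicity_eq card_gt_0_iff)

text \<open>The classes of indices with equal translation partition \<open>[M]\<close>; this makes
  the weights \<open>q_j\<close> sum to 1.\<close>

lemma sum_map_multiplicity: "(\<Sum>j<m. map_multiplicity L M t j) = M"
proof -
  have "(\<Sum>j<m. map_multiplicity L M t j) = card (\<Union>j<m. {i \<in> {..<M}. t i = translations ! j})"
    unfolding map_multiplicity_eq
    using distinct_translations length_translations
    by (intro card_UN_disjoint[symmetric]) (auto simp: nth_eq_iff_index_eq)
  also have "(\<Union>j<m. {i \<in> {..<M}. t i = translations ! j}) = {..<M}"
  proof -
    have "\<exists>j<m. t i = translations ! j" if "i < M" for i
      using translation_index[OF that] by force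
    then show ?thesis by blast
  qed
  finally show ?thesis by simp
qed

section \<open>The self-similar measure\<close>

abbreviation "\<mu> \<equiv> weight_measure L M t"
abbreviation "\<nu> \<equiv> self_similar_measure L M t"

lemma space_weight_measure [simp]: "space \<mu> = {..<m}"
  and sets_weight_measure [simp, measurable_cong]: "sets \<mu> = Pow {..<m}"
  by (simp_all add: weight_measure_def space_point_measure sets_point_measure)

lemma prob_space_weight_measure: "prob_space \<mu>"
proof
  have "emeasure \<mu> (space \<mu>) = (\<Sum>j<m. ennreal (real (map_multiplicity L M t j) / real M))"
    unfolding space_weight_measure unfolding weight_measure_def
    by (rule emeasure_point_measure_finite) auto
  also have "\<dots> = ennreal (real (\<Sum>j<m. map_multiplicity L M t j) / real M)"
    by (subst sum_ennreal) (auto simp: sum_divide_distrib)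
  finally show "emeasure \<mu> (space \<mu>) = 1"
    using M by (simp add: sum_map_multiplicity)
qed

lemma emeasure_weight_measure_pos: "j < m \<Longrightarrow> 0 < emeasure \<mu> {j}"
  using map_multiplicity_pos[of j] M
  by (auto simp: weight_measure_def emeasure_point_measure_finite2)

abbreviation "\<Omega> \<equiv> PiM UNIV (\<lambda>_::nat. \<mu>)"

lemma space_sequences: "s \<in> space \<Omega> \<longleftrightarrow> (\<forall>k. s k < m)"
  by (auto simp: space_PiM)

lemma coding_map_eq:
  assumes "s \<in> space \<Omega>"
  shows "coding_map L M t s = lim (\<lambda>n. compose_word f (map (representative \<circ> s) [0..<n]) 0)"
proof -
  have "compose_word (distinct_map L M t) (map s [0..<n]) =
      compose_word f (map (representative \<circ> s) [0..<n])" for n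
    unfolding map_map[symmetric] using assms
    by (intro compose_word_map_cong) (auto simp: space_sequences distinct_map_representative)
  then show ?thesis by (simp add: coding_map_def)
qed

lemma coding_map_in_cylinder:
  assumes "s \<in> space \<Omega>"
  shows "coding_map L M t s \<in> compose_word f (map (representative \<circ> s) [0..<n]) ` I"
  unfolding coding_map_eq[OF assms] using assms
  by (intro compose_word_prefix_limit) (auto simp: space_sequences representative)

lemma measurable_coding_map [measurable]: "coding_map L M t \<in> borel_measurable \<Omega>"
proof -
  \<comment> \<open>Arbitrary coordinate lists \<open>ks\<close> let the induction peel off the
    outermost map; the tail of \<open>[0..<n]\<close> no longer starts at 0.\<close>
  have "(\<lambda>s. compose_word (distinct_map L M t) (map s ks) 0) \<in> borel_measurable \<Omega>" for ks
  proof (induction ks)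
    case (Cons k ks)
    have step: "compose_word (distinct_map L M t) (map s (k # ks)) 0 =
        (1 / real L) * compose_word (distinct_map L M t) (map s ks) 0 + real (translations ! (s k))" for s
      by (simp add: distinct_map_def[of L M t "s k"])
    have "(\<lambda>s. (1 / real L) * compose_word (distinct_map L M t) (map s ks) 0 +
        real (translations ! (s k))) \<in> borel_measurable \<Omega>"
    proof (intro borel_measurable_add borel_measurable_times borel_measurable_const Cons)
      have "(\<lambda>j. real (translations ! j)) \<in> borel_measurable \<mu>"
        by (auto simp: measurable_def)
      moreover have "(\<lambda>s. s k) \<in> measurable \<Omega> \<mu>" by simp
      ultimately show "(\<lambda>s. real (translations ! (s k))) \<in> borel_measurable \<Omega>"
        by (rule measurable_compose[rotated])
    qed
    then show ?case unfolding step .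
  qed simp
  then show ?thesis unfolding coding_map_def by measurable
qed

text \<open>The sequences beginning with \<open>w\<close> form a cylinder of positive product
  measure, and all of them are coded into the image of \<open>I\<close> under
  \<open>w\<close>.\<close>

lemma self_similar_measure_pos:
  assumes w: "set w \<subseteq> {..<M}" and sub: "compose_word f w ` I \<subseteq> A" and A: "A \<in> sets borel"
  shows "0 < emeasure \<nu> A"
proof -
  define ix where "ix i = (SOME j. j < m \<and> translations ! j = t i)" for i
  have ix: "ix i < m" "translations ! (ix i) = t i" if "i < M" for i
    using someI_ex[OF translation_index[OF that]] by (auto simp: ix_def)
  define n where "n = length w"
  define C where "C = prod_emb UNIV (\<lambda>_. \<mu>) {..<n} (\<Pi>\<^sub>E k\<in>{..<n}. {ix (w ! k)})"
  have wk: "w ! k < M" if "k < n" for k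
    using w that nth_mem[of k w] unfolding n_def by blast
  have ixw: "ix (w ! k) < m" if "k < n" for k
    using wk[OF that] by (rule ix(1))
  have "emeasure \<Omega> C = (\<Prod>k<n. emeasure \<mu> {ix (w ! k)})"
    unfolding C_def by (rule emeasure_PiM_emb) (use prob_space_weight_measure ixw in auto)
  moreover have "(\<Prod>k<n. emeasure \<mu> {ix (w ! k)}) \<noteq> 0"
    using emeasure_weight_measure_pos ixw by (auto simp: prod_zero_iff less_le)
  ultimately have "0 < emeasure \<Omega> C" by (simp add: zero_less_iff_neq_zero)
  also have "emeasure \<Omega> C \<le> emeasure \<Omega> (coding_map L M t -` A \<inter> space \<Omega>)"
  proof (rule emeasure_mono)
    show "coding_map L M t -` A \<inter> space \<Omega> \<in> sets \<Omega>"
      using A by (rule measurable_sets[OF measurable_coding_map])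
    show "C \<subseteq> coding_map L M t -` A \<inter> space \<Omega>"
    proof
      fix s assume "s \<in> C"
      then have s: "s \<in> space \<Omega>" and sk: "\<And>k. k < n \<Longrightarrow> s k = ix (w ! k)"
        by (auto simp: C_def prod_emb_def space_PiM PiE_def Pi_def)
      have "compose_word f (map (representative \<circ> s) [0..<n]) = compose_word (\<lambda>i. f (representative (ix i))) w"
      proof -
        have "map (representative \<circ> s) [0..<n] = map (\<lambda>i. representative (ix i)) (map ((!) w) [0..<n])"
          using sk by auto
        also have "map ((!) w) [0..<n] = w" by (simp add: n_def map_nth)
        finally have eq: "map (representative \<circ> s) [0..<n] = map (\<lambda>i. representative (ix i)) w" .
        show ?thesis unfolding eq by (rule compose_word_map_cong[symmetric]) simp
      qed
      \<comment> \<open>With repeated maps \<open>representative (ix i)\<close> may differ from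
        \<open>i\<close>, but it has the same translation and so gives the same map.\<close>
      also have "\<dots> = compose_word f (map id w)"
      proof (rule compose_word_map_cong)
        fix i assume "i \<in> set w"
        then have "i < M" using w by auto
        then have "t (representative (ix i)) = t i" using ix representative by auto
        then show "f (representative (ix i)) = f (id i)" by (auto simp: ifs_map_def)
      qed
      finally show "s \<in> coding_map L M t -` A \<inter> space \<Omega>"
        using coding_map_in_cylinder[OF s, of n] sub s by auto
    qed
  qed
  also have "\<dots> = emeasure \<nu> A"
    unfolding self_similar_measure_def using A by (simp add: emeasure_distr)
  finally show ?thesis .
qed

section \<open>Basic intervals and the entries of the type matrix\<close>

text \<open>An interval of positive measure contains a coded point, and these lie in the bounded set
  \<open>I\<close>. On an infinite set \<open>card\<close> and \<open>sorted_list_of_set\<close>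
  would return default values and not enumerate the basic types.\<close>

lemma finite_basic_indices: "finite (basic_indices L M t)"
proof (rule finite_subset)
  define D where "D = real L * real (t (M - 1)) / (real L - 1)"
  show "basic_indices L M t \<subseteq> {0..\<lceil>D\<rceil> + 1}"
  proof
    fix i assume "i \<in> basic_indices L M t"
    then have "emeasure \<nu> {of_int (i - 1) * real L .. of_int i * real L} > 0"
      by (simp add: basic_indices_def)
    then have "emeasure \<Omega> (coding_map L M t -` {of_int (i - 1) * real L .. of_int i * real L} \<inter> space \<Omega>) \<noteq> 0"
      unfolding self_similar_measure_def by (simp add: emeasure_distr)
    then obtain s where s: "s \<in> space \<Omega>"
        "coding_map L M t s \<in> {of_int (i - 1) * real L .. of_int i * real L}"
      by (metis (no_types, lifting) IntE emeasure_empty ex_in_conv vimageE)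
    have "coding_map L M t s \<in> I" using coding_map_in_cylinder[OF s(1), of 0] by simp
    then have c: "0 \<le> of_int i * real L" "of_int (i - 1) * real L \<le> D"
      using s(2) by (auto simp: ifs_interval_def D_def)
    have "0 \<le> i" using c(1) L by (simp add: zero_le_mult_iff)
    moreover have "i \<le> \<lceil>D\<rceil> + 1"
    proof (cases "i \<le> 1")
      case True
      have "0 \<le> D" using L by (simp add: D_def)
      then show ?thesis using True by (smt (verit) ceiling_mono ceiling_zero)
    next
      case False
      then have "of_int (i - 1) * 1 \<le> of_int (i - 1) * real L"
        using L by (intro mult_left_mono) auto
      also note c(2)
      finally have "of_int (i - 1) \<le> D" by (simp only: mult_1_right)
      then have "i - 1 \<le> \<lceil>D\<rceil>" by (metis le_of_int_ceiling of_int_le_iff order_trans)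
      then show ?thesis by simp
    qed
    ultimately show "i \<in> {0..\<lceil>D\<rceil> + 1}" by simp
  qed
qed simp

text \<open>
  A combinatorial substitute for \<open>[u L, (u + 1) L]\<close> being a basic interval. Only the implication
  to positive measure is needed, and unlike positive measure this property passes
  trivially from \<open>J\<close> to a basic interval containing \<open>f_i(J)\<close>.
\<close>

definition meets_attractor :: "int \<Rightarrow> bool" where
  "meets_attractor u \<longleftrightarrow> (\<exists>w. set w \<subseteq> {..<M} \<and>
     compose_word f w ` I \<subseteq> {of_int u * real L .. (of_int u + 1) * real L})"

abbreviation "N \<equiv> num_basic L M t"
abbreviation "left \<equiv> basic_left L M t"

text \<open>The offset arises because index \<open>i\<close> stands for
  \<open>[(i - 1) L, i L]\<close>, whereas \<open>u\<close> marks the left end.\<close>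

lemma meets_attractor_basic: "meets_attractor u \<Longrightarrow> u + 1 \<in> basic_indices L M t"
  using self_similar_measure_pos by (force simp: meets_attractor_def basic_indices_def)

text \<open>The equation says that \<open>f i\<close> maps \<open>[u L, (u + 1) L]\<close> onto
  \<open>[v L + a, v L + a + 1]\<close>, which stays inside \<open>[v L, (v + 1) L]\<close> as
  \<open>a < L\<close>. Prefixing \<open>i\<close> to a witness for \<open>u\<close> gives one for
  \<open>v\<close>.\<close>

lemma meets_attractor_step:
  assumes u: "meets_attractor u" and i: "i < M" and a: "a < L"
    and eq: "u + int (t i) = int L * v + int a"
  shows "meets_attractor v"
proof -
  obtain w where w: "set w \<subseteq> {..<M}"
      and sub: "compose_word f w ` I \<subseteq> {of_int u * real L .. (of_int u + 1) * real L}"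
    using u by (auto simp: meets_attractor_def)
  have "real_of_int (u + int (t i)) = real_of_int (int L * v + int a)"
    using eq by simp
  then have eq': "real_of_int u + real (t i) = of_int v * real L + real a" by simp
  have "compose_word f (i # w) ` I = f i ` compose_word f w ` I"
    by (auto simp: image_comp)
  also have "\<dots> \<subseteq> f i ` {of_int u * real L .. (of_int u + 1) * real L}"
    using sub by (rule image_mono)
  also have "\<dots> = {of_int v * real L + real a .. of_int v * real L + real (a + 1)}"
    unfolding ifs_map_image using eq' by (simp add: algebra_simps)
  also have "\<dots> \<subseteq> {of_int v * real L .. (of_int v + 1) * real L}"
  proof -
    have "real (a + 1) \<le> real L" using a by (simp only: of_nat_le_iff)
    then show ?thesis by (auto simp: algebra_simps)
  qed
  finally show ?thesis
    unfolding meets_attractor_def using w i by (intro exI[of _ "i # w"]) auto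
qed

lemma bij_betw_basic_left: "bij_betw left {..<N} ((\<lambda>i. i - 1) ` basic_indices L M t)"
proof -
  have "bij_betw ((!) (sorted_list_of_set (basic_indices L M t))) {..<N} (basic_indices L M t)"
    by (rule bij_betw_nth) (simp_all add: num_basic_def finite_basic_indices)
  moreover have "bij_betw (\<lambda>i. i - 1) (basic_indices L M t) ((\<lambda>i. i - 1) ` basic_indices L M t)"
    by (simp add: bij_betw_def inj_on_def)
  ultimately have "bij_betw ((\<lambda>i. i - 1) \<circ> (!) (sorted_list_of_set (basic_indices L M t))) {..<N}
      ((\<lambda>i. i - 1) ` basic_indices L M t)"
    by (rule bij_betw_trans)
  also have "(\<lambda>i. i - 1) \<circ> (!) (sorted_list_of_set (basic_indices L M t)) = left"
    by (auto simp: basic_left_def)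
  finally show ?thesis .
qed

lemma finite_meets_attractor: "finite (Collect meets_attractor)"
proof (rule finite_subset)
  show "Collect meets_attractor \<subseteq> (\<lambda>i. i - 1) ` basic_indices L M t"
    using meets_attractor_basic by force
qed (simp add: finite_basic_indices)

text \<open>Links the two index sets: the matrix runs over all basic types, the word counts only
  over those with \<open>meets_attractor\<close>. The remaining types enter with 0.\<close>

lemma sum_meets_attractor:
  "(\<Sum>u\<in>Collect meets_attractor. g u) = (\<Sum>k<N. if meets_attractor (left k) then g (left k) else (0::real))"
proof -
  have "(\<Sum>k<N. if meets_attractor (left k) then g (left k) else 0) =
      (\<Sum>u\<in>(\<lambda>i. i - 1) ` basic_indices L M t. if meets_attractor u then g u else 0)"
    by (rule sum.reindex_bij_betw[OF bij_betw_basic_left])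
  also have "\<dots> = (\<Sum>u\<in>Collect meets_attractor. if meets_attractor u then g u else 0)"
  proof (rule sum.mono_neutral_right)
    show "Collect meets_attractor \<subseteq> (\<lambda>i. i - 1) ` basic_indices L M t"
      using meets_attractor_basic by force
  qed (simp_all add: finite_basic_indices)
  also have "\<dots> = (\<Sum>u\<in>Collect meets_attractor. g u)"
    by (rule sum.cong) simp_all
  finally show ?thesis ..
qed

text \<open>Both intervals compared in \<open>type_matrix\<close> have length 1, so they agree as
  soon as their left ends do. The translations of distinct maps differ, so \<open>THE\<close> has a
  unique candidate, whose multiplicity counts the letters solving the equation.\<close>

lemma type_matrix_entry:
  assumes l: "l < N" and k: "k < N"
  shows "type_matrix L M t a $$ (l, k) =
    real (card {i \<in> {..<M}. left k + int (t i) = int L * left l + int a})"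
proof -
  define Q where "Q j \<longleftrightarrow> j < m \<and>
    distinct_map L M t j ` basic_interval L M t k = basic_subinterval L M t l a" for j
  have Q: "Q j \<longleftrightarrow> j < m \<and> left k + int (translations ! j) = int L * left l + int a" for j
  proof (cases "j < m")
    case True
    have "distinct_map L M t j ` basic_interval L M t k =
        {of_int (left k) + real (translations ! j) .. of_int (left k) + 1 + real (translations ! j)}"
      unfolding distinct_map_representative[OF True] basic_interval_def ifs_map_image
      by (simp add: representative[OF True])
    then have "Q j \<longleftrightarrow> of_int (left k) + real (translations ! j) = of_int (left l) * real L + real a"
      using True by (auto simp: Q_def basic_subinterval_def Icc_eq_Icc)
    also have "\<dots> \<longleftrightarrow> real_of_int (left k + int (translations ! j)) = real_of_int (int L * left l + int a)"
      by (simp add: mult.commute)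
    finally show ?thesis using True by (simp only: of_int_eq_iff simp_thms)
  qed (simp add: Q_def)
  have "(if \<exists>j. Q j then real (map_multiplicity L M t (THE j. Q j)) else 0) =
      real (card {i \<in> {..<M}. left k + int (t i) = int L * left l + int a})"
  proof (cases "\<exists>j. Q j")
    case True
    then obtain j where j: "Q j" by blast
    have "j' = j" if "Q j'" for j'
    proof -
      have "j' < m" "j < m" "translations ! j' = translations ! j"
        using that j unfolding Q by auto
      then show "j' = j"
        using distinct_translations length_translations by (simp add: nth_eq_iff_index_eq)
    qed
    then have "(THE j. Q j) = j" using j by blast
    moreover have "{i \<in> {..<M}. left k + int (t i) = int L * left l + int a} =
        {i \<in> {..<M}. t i = translations ! j}"
      using j unfolding Q by auto
    ultimately show ?thesis using True by (simp only: map_multiplicity_eq if_True)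
  next
    case False
    have "{i \<in> {..<M}. left k + int (t i) = int L * left l + int a} = {}"
    proof (rule ccontr)
      assume "{i \<in> {..<M}. left k + int (t i) = int L * left l + int a} \<noteq> {}"
      then obtain i where i: "i < M" "left k + int (t i) = int L * left l + int a" by blast
      obtain j where "j < m" "translations ! j = t i" using translation_index[OF i(1)] by blast
      then have "Q j" unfolding Q using i(2) by simp
      then show False using False by blast
    qed
    then show ?thesis using False by (simp only: if_False card.empty of_nat_0)
  qed
  moreover have "type_matrix L M t a $$ (l, k) =
      (if \<exists>j. Q j then real (map_multiplicity L M t (THE j. Q j)) else 0)"
    unfolding Q_def type_matrix_def Let_def using l k by (simp only: index_mat prod.case)
  ultimately show ?thesis by (simp only:)
qed

section \<open>The counting recursion and its decay\<close>

text \<open>Split off the last letter \<open>i\<close>, which acts first: it moves type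
  \<open>u\<close> to the \<open>a\<close>-th subinterval of some type \<open>u'\<close>, and the
  rest of the word maps type \<open>u'\<close> onto the coarser interval. The number of possible
  \<open>i\<close> is the entry of \<open>A_a\<close> at \<open>(u', u)\<close>.\<close>

lemma words_with_shift_recursion:
  assumes u: "meets_attractor u" and a: "a < L"
  shows "card (words_with_shift L M t (Suc n) (int L * v + int a - u)) \<le>
    (\<Sum>u'\<in>Collect meets_attractor.
       card {i \<in> {..<M}. u + int (t i) = int L * u' + int a} * card (words_with_shift L M t n (v - u')))"
proof -
  define S where "S u' = {i \<in> {..<M}. u + int (t i) = int L * u' + int a} \<times> words_with_shift L M t n (v - u')" for u'
  have finS: "finite (S u')" for u' by (simp add: S_def)
  have "words_with_shift L M t (Suc n) (int L * v + int a - u) \<subseteq>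
      (\<Union>u'\<in>Collect meets_attractor. (\<lambda>(i, w). w @ [i]) ` S u')"
  proof
    fix x assume x: "x \<in> words_with_shift L M t (Suc n) (int L * v + int a - u)"
    then have "length x = Suc n" by (simp add: words_with_shift_def)
    then obtain w i where xw: "x = w @ [i]" by (cases x rule: rev_cases) auto
    then have w: "length w = n" "set w \<subseteq> {..<M}" and i: "i < M"
        and eq: "int L * word_shift L t w + int (t i) = int L * v + int a - u"
      using x by (auto simp: words_with_shift_def)
    define u' where "u' = v - word_shift L t w"
    have eq': "u + int (t i) = int L * u' + int a"
      using eq by (simp add: u'_def algebra_simps)
    have "meets_attractor u'" using u i a eq' by (rule meets_attractor_step)
    moreover have "(i, w) \<in> S u'"
      using w i eq' by (simp add: S_def words_with_shift_def u'_def)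
    ultimately show "x \<in> (\<Union>u'\<in>Collect meets_attractor. (\<lambda>(i, w). w @ [i]) ` S u')"
      unfolding xw by force
  qed
  then have "card (words_with_shift L M t (Suc n) (int L * v + int a - u)) \<le>
      card (\<Union>u'\<in>Collect meets_attractor. (\<lambda>(i, w). w @ [i]) ` S u')"
    by (intro card_mono) (auto simp: finite_meets_attractor finS)
  also have "\<dots> \<le> (\<Sum>u'\<in>Collect meets_attractor. card ((\<lambda>(i, w). w @ [i]) ` S u'))"
    by (rule card_UN_le[OF finite_meets_attractor])
  also have "\<dots> \<le> (\<Sum>u'\<in>Collect meets_attractor. card (S u'))"
    by (intro sum_mono card_image_le finS)
  finally show ?thesis by (simp add: S_def)
qed

text \<open>
  The interval \<open>L^(1 - n0) [v, v + 1]\<close> refined by \<open>n\<close> digits \<open>a\<close> is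
  \<open>L^(1 - n0 - n) [d, d + 1]\<close> with \<open>d = digit_extension a v n\<close>.
\<close>

fun digit_extension :: "nat \<Rightarrow> int \<Rightarrow> nat \<Rightarrow> int" where
  "digit_extension a v 0 = v"
| "digit_extension a v (Suc n) = int L * digit_extension a v n + int a"

text \<open>The factor \<open>p ^ (n0 + n)\<close> is the survival probability of one word, so the
  sum is the expected number of surviving words that map some type onto the \<open>n\<close>-th
  refinement.\<close>

lemma expected_words_tendsto_0:
  assumes a: "a < L" and p: "0 \<le> p"
    and sr: "spectral_radius (map_mat complex_of_real (p \<cdot>\<^sub>m type_matrix L M t a)) < 1"
  shows "(\<lambda>n. \<Sum>u\<in>Collect meets_attractor.
      p ^ (n0 + n) * real (card (words_with_shift L M t (n0 + n) (digit_extension a v n - u)))) \<longlonglongrightarrow> 0"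
proof -
  define W where "W n u = real (card (words_with_shift L M t (n0 + n) (digit_extension a v n - u)))" for n u
  \<comment> \<open>Extension by 0 keeps the recursive inequality on the remaining basic types,
    where its right side is nonnegative.\<close>
  define y where "y n k = (if meets_attractor (left k) then p ^ (n0 + n) * W n (left k) else 0)" for n k
  define B where "B = p \<cdot>\<^sub>m type_matrix L M t a"
  have tm: "type_matrix L M t a \<in> carrier_mat N N" by (simp add: type_matrix_def)
  have entry: "B $$ (l, k) = p * real (card {i \<in> {..<M}. left k + int (t i) = int L * left l + int a})"
    if "l < N" "k < N" for l k
    using that tm by (simp add: B_def type_matrix_entry)
  have "(\<lambda>n. y n k) \<longlonglongrightarrow> 0" if "k < N" for k
  proof (rule nonneg_mat_recursion_tendsto_0[OF _ _ _ _ _ that])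
    show "B \<in> carrier_mat N N" using tm by (simp add: B_def)
    show "spectral_radius (map_mat complex_of_real B) < 1" using sr by (simp add: B_def)
    show "0 \<le> B $$ (i, j)" if "i < N" "j < N" for i j
      using that p by (simp add: entry)
    show nonneg: "0 \<le> y n k" for n k using p by (simp add: y_def W_def)
    show "y (Suc n) k \<le> (\<Sum>l<N. B $$ (l, k) * y n l)" if k: "k < N" for n k
    proof (cases "meets_attractor (left k)")
      case True
      let ?c = "\<lambda>u'. real (card {i \<in> {..<M}. left k + int (t i) = int L * u' + int a})"
      have "W (Suc n) (left k) \<le> (\<Sum>u'\<in>Collect meets_attractor. ?c u' * W n u')"
        using words_with_shift_recursion[OF True a, of "n0 + n" "digit_extension a v n",
            THEN of_nat_mono[where ?'a = real]]
        by (simp add: W_def)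
      then have "y (Suc n) k \<le> p ^ (n0 + Suc n) * (\<Sum>u'\<in>Collect meets_attractor. ?c u' * W n u')"
        unfolding y_def using True p by (simp add: mult_left_mono)
      also have "\<dots> = (\<Sum>u'\<in>Collect meets_attractor. p * ?c u' * (p ^ (n0 + n) * W n u'))"
        by (simp add: sum_distrib_left ac_simps)
      also have "\<dots> = (\<Sum>l<N. if meets_attractor (left l)
          then p * ?c (left l) * (p ^ (n0 + n) * W n (left l)) else 0)"
        by (rule sum_meets_attractor)
      also have "\<dots> = (\<Sum>l<N. B $$ (l, k) * y n l)"
        using k by (intro sum.cong) (auto simp: entry y_def)
      finally show ?thesis .
    next
      case False
      then have "y (Suc n) k = 0" by (simp add: y_def)
      also have "0 \<le> (\<Sum>l<N. B $$ (l, k) * y n l)"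
        using k p nonneg by (intro sum_nonneg mult_nonneg_nonneg) (auto simp: entry)
      finally show ?thesis .
    qed
  qed
  then have "(\<lambda>n. \<Sum>k<N. y n k) \<longlonglongrightarrow> 0"
    by (intro tendsto_null_sum) auto
  also have "(\<lambda>n. \<Sum>k<N. y n k) = (\<lambda>n. \<Sum>u\<in>Collect meets_attractor. p ^ (n0 + n) * W n u)"
    unfolding y_def sum_meets_attractor ..
  finally show ?thesis by (simp add: W_def)
qed

section \<open>Intervals inside the random set force surviving words\<close>

text \<open>Every refinement stays inside the initial interval, because
  \<open>L d + a + 1 \<le> L (d + 1)\<close> for a digit \<open>a < L\<close>.\<close>

lemma digit_extension_bounds:
  assumes "a < L"
  shows "v * int L ^ n \<le> digit_extension a v n" "digit_extension a v n + 1 \<le> (v + 1) * int L ^ n"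
proof (induction n)
  case (Suc n)
  have eq: "v * int L ^ Suc n = int L * (v * int L ^ n)"
    "(v + 1) * int L ^ Suc n = int L * ((v + 1) * int L ^ n)"
    by (simp_all only: power_Suc mult.left_commute)
  have "int L * (v * int L ^ n) \<le> int L * digit_extension a v n"
    using Suc(1) by (rule mult_left_mono) simp
  then show "v * int L ^ Suc n \<le> digit_extension a v (Suc n)"
    unfolding eq digit_extension.simps by linarith
  have "int L * (digit_extension a v n + 1) \<le> int L * ((v + 1) * int L ^ n)"
    using Suc(2) by (rule mult_left_mono) simp
  then show "digit_extension a v (Suc n) + 1 \<le> (v + 1) * int L ^ Suc n"
    unfolding eq(2) digit_extension.simps distrib_left[of "int L" _ 1] using assms by linarith
qed simp_all

lemma ex_power_gt: "\<exists>k\<ge>1. x < real L ^ k"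
proof -
  obtain k where "x < real L ^ k"
    using real_arch_pow[of "real L" x] L by auto
  also have "real L ^ k \<le> real L ^ Suc k"
    using L by (intro power_increasing) auto
  finally show ?thesis by (intro exI[of _ "Suc k"]) simp
qed

text \<open>
  The midpoint of the interval keeps distance \<open>L / 2\<close> from the multiples of \<open>L\<close> after pulling back,
  so the image of a long enough continuation of the word fits inside one interval.
\<close>

lemma coin_tossing_set_point:
  assumes z: "(of_int d + 1 / 2) * real L / real L ^ n \<in> coin_tossing_set L M t lab" and n: "1 \<le> n"
  shows "\<exists>u w. meets_attractor u \<and> w \<in> surviving_words M lab n \<and> word_shift L t w = d - u"
proof -
  define z where "z = (of_int d + 1 / 2) * real L / real L ^ n"
  define D where "D = real L * real (t (M - 1)) / (real L - 1)"
  have Lpos: "0 < real L" using L by simp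
  \<comment> \<open>Images of \<open>I\<close> under words of length \<open>k\<close> are then
    shorter than \<open>L / 2\<close>, the distance from the midpoint to the ends.\<close>
  obtain k where k: "2 * D / real L < real L ^ k" using ex_power_gt by blast
  have "z \<in> coin_tossing_set L M t lab" using z by (simp add: z_def)
  then have "\<exists>w\<in>surviving_words M lab (n + k). z \<in> compose_word f w ` I"
    using n by (auto simp: coin_tossing_set_def)
  then obtain w x where w: "w \<in> surviving_words M lab (n + k)"
      and x: "x \<in> I" and zx: "z = compose_word f w x"
    by blast
  \<comment> \<open>The prefix \<open>w1\<close> survives because survival concerns all prefixes;
    the continuation \<open>w2\<close> will witness \<open>meets_attractor u\<close>.\<close>
  define w1 w2 where "w1 = take n w" and "w2 = drop n w"
  have len: "length w1 = n" "length w2 = k" and set: "set w1 \<subseteq> {..<M}" "set w2 \<subseteq> {..<M}"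
    using w by (auto simp: w1_def w2_def surviving_words_def dest: in_set_takeD in_set_dropD)
  have w1: "w1 \<in> surviving_words M lab n"
    using w len set by (auto simp: w1_def surviving_words_def min_def)
  define u where "u = d - word_shift L t w1"
  have "z = compose_word f w1 (compose_word f w2 x)"
    unfolding zx by (simp add: compose_word_append[symmetric] w1_def w2_def)
  also have "\<dots> = (compose_word f w2 x + real L * of_int (word_shift L t w1)) / real L ^ n"
    by (simp add: compose_word_ifs_map[of w1] len)
  finally have "(of_int d + 1 / 2) * real L = compose_word f w2 x + real L * of_int (word_shift L t w1)"
    using Lpos by (simp add: z_def)
  then have mid: "compose_word f w2 x = (of_int u + 1 / 2) * real L"
    by (simp add: u_def algebra_simps)
  have "compose_word f w2 x' \<in> {of_int u * real L .. (of_int u + 1) * real L}" if x': "x' \<in> I" for x'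
  proof -
    have "compose_word f w2 x' - compose_word f w2 x = (x' - x) / real L ^ k"
      by (simp add: compose_word_ifs_map len diff_divide_distrib[symmetric])
    moreover have "\<bar>(x' - x) / real L ^ k\<bar> \<le> D / real L ^ k"
    proof -
      have "\<bar>x' - x\<bar> \<le> D" using x x' unfolding ifs_interval_def D_def by auto
      then show ?thesis using Lpos by (simp add: abs_divide divide_right_mono)
    qed
    moreover have "D / real L ^ k < real L / 2"
      using k Lpos by (simp add: field_simps)
    ultimately have "\<bar>compose_word f w2 x' - (of_int u + 1 / 2) * real L\<bar> < real L / 2"
      unfolding mid by linarith
    then show ?thesis
      by (simp only: abs_less_iff distrib_right atLeastAtMost_iff) linarith
  qed
  then have "meets_attractor u"
    unfolding meets_attractor_def using set by blast
  moreover have "word_shift L t w1 = d - u" by (simp add: u_def)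
  ultimately show ?thesis using w1 by blast
qed

text \<open>Replaces the uncountably many candidates \<open>J\<close> by the countably many pairs
  \<open>(n0, v)\<close>: an \<open>L\<close>-adic interval inside \<open>J\<close> contains the
  midpoints of all its refinements.\<close>

lemma interval_in_coin_tossing_set_imp_words:
  assumes a: "a < L" and J: "nondegenerate_interval J" and sub: "J \<subseteq> coin_tossing_set L M t lab"
  shows "\<exists>n0\<ge>1. \<exists>v. \<forall>n. \<exists>u w. meets_attractor u \<and> w \<in> surviving_words M lab (n0 + n) \<and>
    word_shift L t w = digit_extension a v n - u"
proof -
  obtain x y where xy: "x \<in> J" "y \<in> J" "x < y" and "is_interval J"
    using J by (auto simp: nondegenerate_interval_def)
  then have xyJ: "z \<in> J" if "x \<le> z" "z \<le> y" for z
    using that by (meson is_interval_1)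
  have Lpos: "0 < real L" using L by simp
  obtain n0 where n0: "1 \<le> n0" "2 * real L / (y - x) < real L ^ n0" using ex_power_gt by blast
  define h where "h = real L / real L ^ n0"
  have h: "0 < h" "2 * h < y - x"
    using n0 xy Lpos by (auto simp: h_def field_simps)
  \<comment> \<open>Rounding up loses less than one cell of length \<open>h\<close>, and
    \<open>2 * h < y - x\<close> leaves room for a whole cell before \<open>y\<close>.\<close>
  define v where "v = \<lceil>x / h\<rceil>"
  have "x / h \<le> of_int v" "of_int v < x / h + 1" by (auto simp: v_def) linarith
  then have v: "x \<le> of_int v * h" "(of_int v + 1) * h < y"
    using h by (auto simp: field_simps)
  have "\<exists>u w. meets_attractor u \<and> w \<in> surviving_words M lab (n0 + n) \<and>
      word_shift L t w = digit_extension a v n - u" for n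
  proof (rule coin_tossing_set_point)
    define d where "d = digit_extension a v n"
    define z where "z = (of_int d + 1 / 2) * real L / real L ^ (n0 + n)"
    have z: "z = (of_int d + 1 / 2) / real L ^ n * h"
      by (simp add: z_def h_def power_add)
    have "real_of_int (v * int L ^ n) \<le> of_int d" "real_of_int (d + 1) \<le> of_int ((v + 1) * int L ^ n)"
      using digit_extension_bounds[OF a, of v n] unfolding d_def of_int_le_iff by auto
    then have "of_int v \<le> (of_int d + 1 / 2) / real L ^ n" "(of_int d + 1 / 2) / real L ^ n \<le> of_int v + 1"
      using Lpos by (auto simp: field_simps)
    then have "of_int v * h \<le> z" "z \<le> (of_int v + 1) * h"
      unfolding z using h(1) by (simp_all only: mult_le_cancel_right_pos)
    then have "z \<in> J" using v by (intro xyJ) auto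
    then show "(of_int (digit_extension a v n) + 1 / 2) * real L / real L ^ (n0 + n) \<in>
        coin_tossing_set L M t lab"
      using sub by (auto simp: z_def d_def)
  qed (use n0 in simp)
  then show ?thesis using n0 by blast
qed

end

section \<open>Survival probabilities and the almost sure conclusion\<close>

lemma prob_surviving_word:
  assumes "prob_space P"
    and indep: "prob_space.indep_vars P (\<lambda>_. count_space UNIV) X (nonempty_words M)"
    and bernoulli: "\<And>w. w \<in> nonempty_words M \<Longrightarrow>
      distr P (count_space UNIV) (X w) = measure_pmf (bernoulli_pmf p)"
    and p: "0 \<le> p" "p \<le> 1"
    and w: "set w \<subseteq> {..<M}" "w \<noteq> []"
  defines "E \<equiv> {\<omega> \<in> space P. w \<in> surviving_words M (\<lambda>v. X v \<omega>) (length w)}"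
  shows "E \<in> sets P" and "measure P E = p ^ length w"
proof -
  interpret prob_space P by fact
  have ne: "take k w \<in> nonempty_words M" if "k \<in> {1..length w}" for k
    using that w by (auto simp: nonempty_words_def dest: in_set_takeD)
  have rv: "random_variable (count_space UNIV) (X v)" if "v \<in> nonempty_words M" for v
    using indep that by (auto simp: indep_vars_def)
  have prob1: "prob (X v -` {True} \<inter> space P) = p" if v: "v \<in> nonempty_words M" for v
  proof -
    have "prob (X v -` {True} \<inter> space P) = measure (distr P (count_space UNIV) (X v)) {True}"
      using rv[OF v] by (simp add: measure_distr)
    also have "\<dots> = p" using p by (simp add: bernoulli[OF v] measure_pmf_single)
    finally show ?thesis .
  qed
  \<comment> \<open>The prefixes whose labels decide survival. They start at length 1, since the
    empty word has no label, and are distinct because their lengths differ.\<close>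
  define V where "V = (\<lambda>k. take k w) ` {1..length w}"
  have V: "V \<noteq> {}" "finite V" "V \<subseteq> nonempty_words M"
    using w ne by (auto simp: V_def Suc_le_eq)
  have E: "E = (\<Inter>v\<in>V. X v -` {True} \<inter> space P)"
    using w by (auto simp: E_def V_def surviving_words_def Suc_le_eq)
  show "E \<in> sets P"
    unfolding E using V rv by (intro sets.finite_INT) (auto intro!: measurable_sets)
  have "card V = length w"
    unfolding V_def by (subst card_image) (auto simp: inj_on_def dest: arg_cong[where f = length])
  have "prob E = (\<Prod>v\<in>V. prob (X v -` {True} \<inter> space P))"
    unfolding E using V by (intro indep_varsD[OF indep]) auto
  also have "\<dots> = (\<Prod>v\<in>V. p)"
    using V prob1 by (intro prod.cong) auto
  finally show "prob E = p ^ length w"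
    using \<open>card V = length w\<close> by simp
qed

theorem theorem1p10:
  fixes L M :: nat
    and t :: "nat \<Rightarrow> nat"
    and p :: real
    and P :: "'w measure"
    and X :: "nat list \<Rightarrow> 'w \<Rightarrow> bool"
  assumes "L \<ge> 2"
    and "M \<ge> 1"
    and "t 0 = 0"
    and "mono_on {..<M} t"
    and "(L - 1) dvd t (M - 1)"
    and "0 < p" and "p < 1"
    and "prob_space P"
    and "prob_space.indep_vars P (\<lambda>_. count_space UNIV) X (nonempty_words M)"
    and "\<And>w. w \<in> nonempty_words M \<Longrightarrow>
           distr P (count_space UNIV) (X w) = measure_pmf (bernoulli_pmf p)"
    and "\<exists>a<L. spectral_radius (map_mat complex_of_real (p \<cdot>\<^sub>m type_matrix L M t a)) < 1"
  shows "AE \<omega> in P. \<not> (\<exists>J. nondegenerate_interval J \<and>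
           J \<subseteq> coin_tossing_set L M t (\<lambda>w. X w \<omega>))"
proof -
  interpret prob_space P by fact
  interpret integer_ifs L M t
    using assms by unfold_locales auto
  obtain a where a: "a < L"
      and sr: "spectral_radius (map_mat complex_of_real (p \<cdot>\<^sub>m type_matrix L M t a)) < 1"
    using assms by blast
  define G where "G = Collect meets_attractor"
  have finG: "finite G" by (simp add: G_def finite_meets_attractor)
  define S where "S w = {\<omega> \<in> space P. w \<in> surviving_words M (\<lambda>v. X v \<omega>) (length w)}" for w
  have S: "S w \<in> sets P" "prob (S w) = p ^ length w" if "set w \<subseteq> {..<M}" "w \<noteq> []" for w
    using prob_surviving_word[OF assms(8-10) _ _ that] assms by (auto simp: S_def)
  have null: "AE \<omega> in P. \<not> (\<forall>n. \<exists>u w. meets_attractor u \<and>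
      w \<in> surviving_words M (\<lambda>w. X w \<omega>) (n0 + n) \<and> word_shift L t w = digit_extension a v n - u)"
    if n0: "1 \<le> n0" for n0 v
  proof -
    define W where "W n u = words_with_shift L M t (n0 + n) (digit_extension a v n - u)" for n u
    \<comment> \<open>The event that some type is mapped onto the \<open>n\<close>-th refinement by
      a surviving word. A union bound estimates it by the expected number of such words.\<close>
    define E where "E n = (\<Union>u\<in>G. \<Union>w\<in>W n u. S w)" for n
    have W: "finite (W n u)" and W': "\<And>w. w \<in> W n u \<Longrightarrow> set w \<subseteq> {..<M} \<and> w \<noteq> [] \<and> length w = n0 + n"
      for n u
      using n0 unfolding W_def by (simp, auto simp: words_with_shift_def)
    have SW: "w \<in> W n u \<Longrightarrow> S w \<in> sets P" for w n u
      using W' S by blast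
    have UW: "(\<Union>w\<in>W n u. S w) \<in> sets P" for n u
      using W SW by (intro sets.finite_UN) auto
    have E: "E n \<in> sets P" for n
      unfolding E_def by (intro sets.finite_UN finG UW)
    have "prob (E n) \<le> (\<Sum>u\<in>G. p ^ (n0 + n) * real (card (W n u)))" for n
    proof -
      have "prob (E n) \<le> (\<Sum>u\<in>G. prob (\<Union>w\<in>W n u. S w))"
        unfolding E_def by (intro finite_measure_subadditive_finite finG image_subsetI UW)
      also have "\<dots> \<le> (\<Sum>u\<in>G. \<Sum>w\<in>W n u. prob (S w))"
        by (intro sum_mono finite_measure_subadditive_finite W image_subsetI SW)
      also have "\<dots> = (\<Sum>u\<in>G. \<Sum>w\<in>W n u. p ^ (n0 + n))"
        using W' S by (intro sum.cong) auto
      finally show ?thesis by (simp add: mult.commute)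
    qed
    \<comment> \<open>The intersection lies in each single \<open>E n\<close>, so no monotonicity of
      these events is required.\<close>
    then have "prob (\<Inter>n. E n) \<le> (\<Sum>u\<in>G. p ^ (n0 + n) * real (card (W n u)))" for n
      by (rule order_trans[rotated]) (intro finite_measure_mono E, auto)
    moreover have "(\<lambda>n. \<Sum>u\<in>G. p ^ (n0 + n) * real (card (W n u))) \<longlonglongrightarrow> 0"
      unfolding W_def G_def using assms(6) by (intro expected_words_tendsto_0 a sr) simp
    ultimately have "prob (\<Inter>n. E n) \<le> 0"
      by (intro LIMSEQ_le_const) auto
    then have "prob (\<Inter>n. E n) = 0" by (simp add: measure_le_0_iff)
    moreover have "(\<Inter>n. E n) \<in> sets P" using E by (intro sets.countable_INT) auto
    ultimately have "AE \<omega> in P. \<omega> \<notin> (\<Inter>n. E n)" by (simp only: prob_eq_0)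
    then show ?thesis
    proof (rule AE_mp, intro AE_I2 impI notI)
      fix \<omega> assume \<omega>: "\<omega> \<in> space P" and nE: "\<omega> \<notin> (\<Inter>n. E n)"
        and all: "\<forall>n. \<exists>u w. meets_attractor u \<and>
          w \<in> surviving_words M (\<lambda>w. X w \<omega>) (n0 + n) \<and> word_shift L t w = digit_extension a v n - u"
      have "\<omega> \<in> E n" for n
      proof -
        obtain u w where uw: "meets_attractor u" "w \<in> surviving_words M (\<lambda>w. X w \<omega>) (n0 + n)"
            "word_shift L t w = digit_extension a v n - u"
          using all by blast
        then have "w \<in> W n u" "\<omega> \<in> S w"
          using \<omega> by (auto simp: W_def words_with_shift_def S_def surviving_words_def)
        then show ?thesis using uw(1) by (auto simp: E_def G_def)
      qed
      then show False using nE by blast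
    qed
  qed
  \<comment> \<open>Only countably many pairs \<open>(n0, v)\<close> occur, so the exceptional null
    sets combine into one.\<close>
  have "AE \<omega> in P. \<forall>n0 v. 1 \<le> n0 \<longrightarrow> \<not> (\<forall>n. \<exists>u w. meets_attractor u \<and>
      w \<in> surviving_words M (\<lambda>w. X w \<omega>) (n0 + n) \<and> word_shift L t w = digit_extension a v n - u)"
    unfolding AE_all_countable using null by (auto intro: AE_mp)
  then show ?thesis
  proof (rule AE_mp, intro AE_I2 impI notI)
    fix \<omega>
    assume none: "\<forall>n0 v. 1 \<le> n0 \<longrightarrow> \<not> (\<forall>n. \<exists>u w. meets_attractor u \<and>
        w \<in> surviving_words M (\<lambda>w. X w \<omega>) (n0 + n) \<and> word_shift L t w = digit_extension a v n - u)"
      and ex: "\<exists>J. nondegenerate_interval J \<and> J \<subseteq> coin_tossing_set L M t (\<lambda>w. X w \<omega>)"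
    obtain J where J: "nondegenerate_interval J" "J \<subseteq> coin_tossing_set L M t (\<lambda>w. X w \<omega>)"
      using ex by blast
    show False using interval_in_coin_tossing_set_imp_words[OF a J] none by blast
  qed
qed

end
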